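(* Let $p\in(0,2)$. (i) For every $\alpha\in(0,1)$ and every positive function $f\in C^\alpha(\mathbb{S}^1)$ there exists a constant $C_{p,f}\ge 1$, depending only on $p$ and $f$, such that every positive classical solution $u$ of $$u_{\theta\theta}+u=f\,u^{p-1}\quad\text{on }\mathbb{S}^1$$ satisfies $$C_{p,f}^{-1}\le w^-\le w^+\le C_{p,f},$$ where $$w^-=\min_{\theta\in[0,2\pi)}\big(u(\theta)+u(\theta+\pi)\big),\qquad w^+=\max_{\theta\in[0,2\pi)}\big(u(\theta)+u(\theta+\pi)\big).$$ (ii) However, there is a positive function $f\in C^\alpha(\mathbb{S}^1)$, for some $\alpha\in(0,1)$, such that the equation $u_{\theta\theta}+u=f\,u^{p-1}$ on $\mathbb{S}^1$ admits a solution $u$ which is nonnegative but not positive, i.e. $u\ge 0$ on $\mathbb{S}^1$ and $u$ vanishes at some point of $\mathbb{S}^1$.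
   Context: $\mathbb{S}^1$ is the unit circle with arc-length parameter $\theta$; functions on $\mathbb{S}^1$ are identified with $2\pi$-periodic functions of $\theta$. For $f\in C^\alpha(\mathbb{S}^1)$ with $f>0$, a positive classical solution of $u_{\theta\theta}+u=fu^{p-1}$ is a function $u\in C^{2,\alpha}(\mathbb{S}^1)$ with $u>0$ everywhere satisfying the equation pointwise. Such a $u$ is the support function of a convex body $\Omega\subset\mathbb{R}^2$, and $w^\pm$ are the maximal and minimal widths of $\Omega$. A nonnegative solution which may vanish is understood in the generalized sense: $u\ge0$ is a continuous function (the support function of a convex body), $fu^{p-1}$ is integrable on $\mathbb{S}^1$, and $u_{\theta\theta}+u=fu^{p-1}$ holds in the sense of distributions. *)

theory Defs
  imports "HOL-Analysis.Analysis" "HOL-Library.Periodic_Fun"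
begin

text \<open>
  Functions on the unit circle are functions of the arc-length parameter on the real line with
  period \<open>2 * pi\<close>, expressed by the library locale predicate \<open>periodic_fun_simple\<close>.
\<close>

abbreviation circle_fun :: "(real \<Rightarrow> real) \<Rightarrow> bool" where
  "circle_fun u \<equiv> periodic_fun_simple u (2 * pi)"

text \<open>
  For periodic functions, this estimate on the whole line is equivalent, with the same constant,
  to the estimate with respect to the geodesic distance of the circle.
\<close>

definition holder_circle :: "real \<Rightarrow> (real \<Rightarrow> real) \<Rightarrow> bool" where
  "holder_circle \<alpha> f \<longleftrightarrow>
     circle_fun f \<and> (\<exists>K. \<forall>x y. \<bar>f x - f y\<bar> \<le> K * \<bar>x - y\<bar> powr \<alpha>)"

definition holder2_circle :: "real \<Rightarrow> (real \<Rightarrow> real) \<Rightarrow> bool" where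
  "holder2_circle \<alpha> u \<longleftrightarrow>
     circle_fun u \<and>
     (\<forall>\<theta>. u differentiable (at \<theta>)) \<and>
     (\<forall>\<theta>. deriv u differentiable (at \<theta>)) \<and>
     holder_circle \<alpha> (deriv (deriv u))"

definition positive_classical_solution ::
  "real \<Rightarrow> real \<Rightarrow> (real \<Rightarrow> real) \<Rightarrow> (real \<Rightarrow> real) \<Rightarrow> bool" where
  "positive_classical_solution p \<alpha> f u \<longleftrightarrow>
     holder2_circle \<alpha> u \<and> (\<forall>\<theta>. u \<theta> > 0) \<and>
     (\<forall>\<theta>. deriv (deriv u) \<theta> + u \<theta> = f \<theta> * u \<theta> powr (p - 1))"

definition min_width :: "(real \<Rightarrow> real) \<Rightarrow> real" where
  "min_width u = (INF \<theta>\<in>{0..<2 * pi}. u \<theta> + u (\<theta> + pi))"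

definition max_width :: "(real \<Rightarrow> real) \<Rightarrow> real" where
  "max_width u = (SUP \<theta>\<in>{0..<2 * pi}. u \<theta> + u (\<theta> + pi))"

text \<open>For continuous functions on the circle these are a minimum and a maximum.\<close>

lemma circle_fun_shift:
  assumes "circle_fun u"
  shows "u (\<theta> + 2 * pi) = u \<theta>"
  using periodic_fun_simple.plus_period[OF assms] .

lemma width_bounds_attained:
  assumes per: "circle_fun u" and cont: "continuous_on UNIV u"
  shows "\<exists>\<theta>\<in>{0..<2 * pi}. min_width u = u \<theta> + u (\<theta> + pi)"
    and "\<exists>\<theta>\<in>{0..<2 * pi}. max_width u = u \<theta> + u (\<theta> + pi)"
    and "\<And>\<theta>. min_width u \<le> u \<theta> + u (\<theta> + pi)"
    and "\<And>\<theta>. u \<theta> + u (\<theta> + pi) \<le> max_width u"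
proof -
  define w where "w = (\<lambda>\<theta>. u \<theta> + u (\<theta> + pi))"
  have wper: "circle_fun w"
  proof
    fix x show "w (x + 2 * pi) = w x"
      unfolding w_def using circle_fun_shift[OF per, of x] circle_fun_shift[OF per, of "x + pi"]
      by (simp add: algebra_simps)
  qed
  interpret w: periodic_fun_simple w "2 * pi"
    by (fact wper)
  have wcont: "continuous_on {0..2 * pi} w"
    unfolding w_def
    by (intro continuous_intros continuous_on_subset[OF cont]
          continuous_on_compose2[OF cont]) auto
  have rep: "\<exists>t\<in>{0..<2 * pi}. w t = w \<theta>" for \<theta>
  proof -
    define n where "n = \<lfloor>\<theta> / (2 * pi)\<rfloor>"
    define t where "t = \<theta> - of_int n * (2 * pi)"
    have "of_int n \<le> \<theta> / (2 * pi)" "\<theta> / (2 * pi) < of_int n + 1"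
      unfolding n_def by linarith+
    then have "t \<in> {0..<2 * pi}"
      unfolding t_def by (simp add: field_simps)
    moreover have "w t = w \<theta>"
      using w.minus_of_int[of \<theta> n] by (simp add: t_def)
    ultimately show ?thesis by blast
  qed
  obtain a where a: "\<And>t. t \<in> {0..2 * pi} \<Longrightarrow> w a \<le> w t"
    using continuous_attains_inf[OF compact_Icc _ wcont] by fastforce
  obtain b where b: "\<And>t. t \<in> {0..2 * pi} \<Longrightarrow> w t \<le> w b"
    using continuous_attains_sup[OF compact_Icc _ wcont] by fastforce
  have lo: "w a \<le> w t" and hi: "w t \<le> w b" for t
    using rep[of t] a b by (metis atLeastAtMost_iff atLeastLessThan_iff less_imp_le)+
  obtain a' b' where ab: "a' \<in> {0..<2 * pi}" "w a' = w a" "b' \<in> {0..<2 * pi}" "w b' = w b"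
    using rep by metis
  have mi: "min_width u = w a'"
  proof -
    have "min_width u = Inf (w ` {0..<2 * pi})"
      by (simp add: min_width_def w_def)
    also have "\<dots> = w a'"
      by (rule cInf_eq_minimum) (use imageI[OF ab(1), of w] ab lo in auto)
    finally show ?thesis .
  qed
  have ma: "max_width u = w b'"
  proof -
    have "max_width u = Sup (w ` {0..<2 * pi})"
      by (simp add: max_width_def w_def)
    also have "\<dots> = w b'"
      by (rule cSup_eq_maximum) (use imageI[OF ab(3), of w] ab hi in auto)
    finally show ?thesis .
  qed
  show "\<exists>\<theta>\<in>{0..<2 * pi}. min_width u = u \<theta> + u (\<theta> + pi)"
    using mi ab(1) unfolding w_def by blast
  show "\<exists>\<theta>\<in>{0..<2 * pi}. max_width u = u \<theta> + u (\<theta> + pi)"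
    using ma ab(3) unfolding w_def by blast
  show "\<And>\<theta>. min_width u \<le> u \<theta> + u (\<theta> + pi)"
    using mi ab(2) lo unfolding w_def by simp
  show "\<And>\<theta>. u \<theta> + u (\<theta> + pi) \<le> max_width u"
    using ma ab(4) hi unfolding w_def by simp
qed

text \<open>
  Convex bodies have nonempty interior; otherwise, for \<open>p > 1\<close>, the zero function (the support
  function of a point) would be a nonnegative generalized solution.
\<close>

definition convex_body :: "(real ^ 2) set \<Rightarrow> bool" where
  "convex_body \<Omega> \<longleftrightarrow> convex \<Omega> \<and> compact \<Omega> \<and> interior \<Omega> \<noteq> {}"

definition support_function :: "(real ^ 2) set \<Rightarrow> real \<Rightarrow> real" where
  "support_function \<Omega> \<theta> = (SUP x\<in>\<Omega>. x \<bullet> vector [cos \<theta>, sin \<theta>])"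

text \<open>
  Powers of nonnegative reals with values in \<open>[0, \<infinity>]\<close>: a negative power of 0 is \<open>\<infinity>\<close> and its zeroth
  power is 1, whereas \<open>powr\<close> yields 0 in both cases.
\<close>

definition ext_powr :: "real \<Rightarrow> real \<Rightarrow> ennreal" where
  "ext_powr t q =
     (if t = 0 then (if q < 0 then \<infinity> else if q = 0 then 1 else 0) else ennreal (t powr q))"

definition circle_test_function :: "(real \<Rightarrow> real) \<Rightarrow> bool" where
  "circle_test_function \<phi> \<longleftrightarrow>
     circle_fun \<phi> \<and> (\<forall>n \<theta>. (deriv ^^ n) \<phi> differentiable (at \<theta>))"

text \<open>
  The finiteness condition is the integrability of the right-hand side over the circle; in
  particular the right-hand side is finite almost everywhere, so \<open>enn2real\<close> in the
  distributional equation alters it only on a null set.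
\<close>

definition nonneg_generalized_solution ::
  "real \<Rightarrow> (real \<Rightarrow> real) \<Rightarrow> (real \<Rightarrow> real) \<Rightarrow> bool" where
  "nonneg_generalized_solution p f u \<longleftrightarrow>
     circle_fun u \<and> continuous_on UNIV u \<and> (\<forall>\<theta>. u \<theta> \<ge> 0) \<and>
     (\<exists>\<Omega>. convex_body \<Omega> \<and> (\<forall>\<theta>. u \<theta> = support_function \<Omega> \<theta>)) \<and>
     (\<integral>\<^sup>+\<theta>\<in>{0..2 * pi}. ennreal (f \<theta>) * ext_powr (u \<theta>) (p - 1) \<partial>lborel) < \<infinity> \<and>
     (\<forall>\<phi>. circle_test_function \<phi> \<longrightarrow>
        (LINT \<theta>:{0..2 * pi}|lborel. u \<theta> * (deriv (deriv \<phi>) \<theta> + \<phi> \<theta>)) =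
        (LINT \<theta>:{0..2 * pi}|lborel. f \<theta> * enn2real (ext_powr (u \<theta>) (p - 1)) * \<phi> \<theta>))"

end

theory Submission
  imports Defs
begin

text \<open>
  The upper bound is an energy argument: where \<open>u\<close> decreases, \<open>u'\<^sup>2/2 + u\<^sup>2/2 - M u\<^sup>p/p\<close> with
  \<open>M = max f\<close> does not decrease, which bounds \<open>max u\<close> by comparison of a maximum point with the next
  critical point. At a maximum \<open>u'' \<le> 0\<close> bounds \<open>max u\<close> from below. Since \<open>u\<close> lies above
  \<open>max u \<cdot> cos\<close> around its maximum, \<open>f u\<^sup>p\<^sup>-\<^sup>1\<close> is bounded below on an arc, and the formula
  \<open>u(\<theta>) + u(\<theta> + \<pi>) = \<integral> f u\<^sup>p\<^sup>-\<^sup>1 sin(s - \<theta>) ds\<close> over \<open>[\<theta>, \<theta> + \<pi>]\<close> bounds all widths below.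
  The solution with a zero is explicit.
\<close>

section \<open>Periodic functions: representatives and extrema\<close>

text \<open>One point \<open>t\<close> serves all periodic \<open>v\<close> at once. This matters
  where several functions have to be moved together, such as \<open>u\<close>, \<open>cos\<close>
  and \<open>sin\<close> in \<open>convex_body_support_function\<close>.\<close>

lemma circle_fun_translate:
  obtains t where "t \<in> {\<theta>..<\<theta> + 2 * pi}" "\<And>v. circle_fun v \<Longrightarrow> v t = v \<phi>"
proof -
  define n where "n = \<lfloor>(\<phi> - \<theta>) / (2 * pi)\<rfloor>"
  define t where "t = \<phi> - of_int n * (2 * pi)"
  have "of_int n \<le> (\<phi> - \<theta>) / (2 * pi)" "(\<phi> - \<theta>) / (2 * pi) < of_int n + 1"
    unfolding n_def by linarith+
  then have "t \<in> {\<theta>..<\<theta> + 2 * pi}"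
    unfolding t_def by (simp add: field_simps)
  moreover have "v t = v \<phi>" if "circle_fun v" for v
  proof -
    interpret periodic_fun_simple v "2 * pi" by (fact that)
    show ?thesis using minus_of_int[of \<phi> n] by (simp add: t_def)
  qed
  ultimately show ?thesis using that by blast
qed

lemma circle_fun_attains_sup:
  assumes "circle_fun u" "continuous_on UNIV u"
  obtains x where "\<And>t. u t \<le> u x"
proof -
  obtain b where b: "\<And>t. t \<in> {0..2 * pi} \<Longrightarrow> u t \<le> u b"
    using continuous_attains_sup[OF compact_Icc _ continuous_on_subset[OF assms(2)], of 0 "2 * pi"]
    by fastforce
  have "u t \<le> u b" for t
  proof -
    obtain s where "s \<in> {0..<0 + 2 * pi}" "u s = u t"
      using circle_fun_translate[of 0 t] assms(1) by metis
    then show ?thesis using b[of s] by auto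
  qed
  then show ?thesis using that by blast
qed

lemma circle_fun_attains_inf:
  assumes "circle_fun u" "continuous_on UNIV u"
  obtains x where "\<And>t. u x \<le> u t"
proof -
  have "circle_fun (\<lambda>x. - u x)"
    using circle_fun_shift[OF assms(1)] by (simp add: periodic_fun_simple_def)
  then show ?thesis
    using circle_fun_attains_sup[of "\<lambda>x. - u x"] assms(2) that
    by (metis continuous_on_minus neg_le_iff_le)
qed

section \<open>The equation in integrated form and its geometric consequences\<close>

text \<open>
  The equation \<open>u'' + u = F\<close> with \<open>F \<ge> 0\<close> outside a locally finite exceptional set, where \<open>u1\<close>
  plays the role of \<open>u'\<close>; at exceptional points nothing but continuity is required.
\<close>

locale support_ode =
  fixes u u1 F :: "real \<Rightarrow> real" and S :: "real set"
  assumes cont_u: "continuous_on UNIV u"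
    and cont_u1: "continuous_on UNIV u1"
    and finite_S: "\<And>a b. finite (S \<inter> {a..b})"
    and F_nonneg: "\<And>x. F x \<ge> 0"
    and deriv_u: "\<And>x. x \<notin> S \<Longrightarrow> (u has_real_derivative u1 x) (at x)"
    and deriv_u1: "\<And>x. x \<notin> S \<Longrightarrow> (u1 has_real_derivative F x - u x) (at x)"
begin

text \<open>Variation of constants: as a function of s, sin(\<phi> - s) solves the homogeneous
  equation, so the derivative of u1 sin(\<phi> - s) + u cos(\<phi> - s) is F sin(\<phi> - s), all
  other terms cancelling. The strong form of the fundamental theorem tolerates the finitely many
  exceptional points.\<close>

lemma has_integral_sine_kernel:
  assumes "a \<le> b"
  shows "((\<lambda>s. F s * sin (\<phi> - s)) has_integral
      (u1 b * sin (\<phi> - b) + u b * cos (\<phi> - b)) - (u1 a * sin (\<phi> - a) + u a * cos (\<phi> - a))) {a..b}"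
proof (rule fundamental_theorem_of_calculus_strong[OF finite_S[of a b] assms])
  fix x assume "x \<in> {a..b} - (S \<inter> {a..b})"
  then have x: "x \<notin> S" by auto
  show "((\<lambda>s. u1 s * sin (\<phi> - s) + u s * cos (\<phi> - s)) has_vector_derivative F x * sin (\<phi> - x)) (at x)"
    unfolding has_real_derivative_iff_has_vector_derivative[symmetric]
    by (rule derivative_eq_intros deriv_u[OF x] deriv_u1[OF x] refl)+ (simp add: algebra_simps)
qed (intro continuous_intros continuous_on_subset[OF cont_u] continuous_on_subset[OF cont_u1]; simp)

text \<open>The left-hand side solves the homogeneous equation with the data of \<open>u\<close> at
  \<theta>. By the sine kernel formula, \<open>u\<close> minus it is an integral of F times a sine
  that keeps its sign as long as the distance is at most \<pi>. Geometrically, it is the support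
  function of a boundary point of the body.\<close>

lemma above_tangent_circle:
  assumes "\<bar>\<phi> - \<theta>\<bar> \<le> pi"
  shows "u \<theta> * cos (\<phi> - \<theta>) + u1 \<theta> * sin (\<phi> - \<theta>) \<le> u \<phi>"
proof (cases "\<theta> \<le> \<phi>")
  case True
  have "0 \<le> (u1 \<phi> * sin (\<phi> - \<phi>) + u \<phi> * cos (\<phi> - \<phi>)) - (u1 \<theta> * sin (\<phi> - \<theta>) + u \<theta> * cos (\<phi> - \<theta>))"
    by (rule has_integral_nonneg[OF has_integral_sine_kernel[OF True, of \<phi>]])
      (use assms in \<open>auto intro!: mult_nonneg_nonneg F_nonneg sin_ge_zero\<close>)
  then show ?thesis by simp
next
  case False
  then have "\<phi> \<le> \<theta>" by simp
  have "(u1 \<theta> * sin (\<phi> - \<theta>) + u \<theta> * cos (\<phi> - \<theta>)) - (u1 \<phi> * sin (\<phi> - \<phi>) + u \<phi> * cos (\<phi> - \<phi>)) \<le> 0"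
  proof (rule has_integral_le[OF has_integral_sine_kernel[OF \<open>\<phi> \<le> \<theta>\<close>, of \<phi>] has_integral_0])
    fix s assume "s \<in> {\<phi>..\<theta>}"
    then have "0 \<le> sin (s - \<phi>)" using assms by (intro sin_ge_zero) auto
    then have "0 \<le> F s * sin (s - \<phi>)" using F_nonneg by simp
    moreover have "sin (\<phi> - s) = - sin (s - \<phi>)" by (metis minus_diff_eq sin_minus)
    ultimately show "F s * sin (\<phi> - s) \<le> 0" by simp
  qed
  then show ?thesis by simp
qed

text \<open>The primitive \<open>P\<close> of the sine kernel formula goes from u(\<theta>) down to
  -u(\<theta> + \<pi>), so the width is its total decrease. It is nonincreasing on the whole half
  circle and loses at least c (b - a) on [a, b].\<close>

lemma width_ge:
  assumes "\<theta> \<le> a" "a \<le> b" "b \<le> \<theta> + pi"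
    and c: "\<And>s. s \<in> {a..b} \<Longrightarrow> c \<le> F s * sin (s - \<theta>)"
  shows "c * (b - a) \<le> u \<theta> + u (\<theta> + pi)"
proof -
  define P where "P s = u1 s * sin (\<theta> - s) + u s * cos (\<theta> - s)" for s
  have sin_flip: "sin (\<theta> - s) = - sin (s - \<theta>)" for s by (metis minus_diff_eq sin_minus)
  have int: "((\<lambda>s. F s * sin (\<theta> - s)) has_integral P y - P x) {x..y}" if "x \<le> y" for x y
    unfolding P_def by (rule has_integral_sine_kernel[OF that])
  have neg: "P y \<le> P x" if "x \<le> y" "\<theta> \<le> x" "y \<le> \<theta> + pi" for x y
  proof -
    have "P y - P x \<le> 0"
    proof (rule has_integral_le[OF int[OF that(1)] has_integral_0])
      fix s assume "s \<in> {x..y}"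
      then have "0 \<le> sin (s - \<theta>)" using that by (intro sin_ge_zero) auto
      then show "F s * sin (\<theta> - s) \<le> 0" using F_nonneg[of s] by (simp add: sin_flip)
    qed
    then show ?thesis by simp
  qed
  have "((\<lambda>s. - c) has_integral - c * (b - a)) {a..b}"
    using has_integral_const_real[of "- c" a b] assms by (simp add: mult.commute)
  then have "P b - P a \<le> - c * (b - a)"
    by (rule has_integral_le[OF int[OF \<open>a \<le> b\<close>]]) (use c in \<open>force simp: sin_flip\<close>)
  moreover have "P a \<le> P \<theta>" "P (\<theta> + pi) \<le> P b" using neg assms by auto
  moreover have "P \<theta> = u \<theta>" "P (\<theta> + pi) = - u (\<theta> + pi)" by (simp_all add: P_def)
  ultimately show ?thesis by linarith
qed

end

section \<open>A priori bounds for positive classical solutions\<close>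

lemma holder_circle_continuous:
  assumes "holder_circle \<alpha> f" "0 < \<alpha>"
  shows "continuous_on UNIV f"
proof -
  obtain K where K: "\<And>x y. \<bar>f x - f y\<bar> \<le> K * \<bar>x - y\<bar> powr \<alpha>"
    using assms(1) by (auto simp: holder_circle_def)
  have "(f \<longlongrightarrow> f x) (at x)" for x
  proof -
    have "((\<lambda>y. K * \<bar>y - x\<bar> powr \<alpha>) \<longlongrightarrow> K * \<bar>x - x\<bar> powr \<alpha>) (at x)"
      by (intro tendsto_intros tendsto_powr') (use assms(2) in auto)
    then have "((\<lambda>y. K * \<bar>y - x\<bar> powr \<alpha>) \<longlongrightarrow> 0) (at x)"
      by simp
    then have "((\<lambda>y. f y - f x) \<longlongrightarrow> 0) (at x)"
      by (rule Lim_null_comparison[rotated]) (use K in \<open>auto intro!: always_eventually\<close>)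
    then show ?thesis using LIM_zero_cancel by blast
  qed
  then show ?thesis by (simp add: continuous_on_def)
qed

lemma pos_solution_support_ode:
  assumes "positive_classical_solution p \<alpha> f u" "\<And>x. f x > 0"
  shows "support_ode u (deriv u) (\<lambda>x. f x * u x powr (p - 1)) {}"
    and "circle_fun u" and "\<And>x. u x > 0"
proof -
  have d: "(u has_real_derivative deriv u x) (at x)"
    and d2: "(deriv u has_real_derivative deriv (deriv u) x) (at x)"
    and eq: "deriv (deriv u) x = f x * u x powr (p - 1) - u x" for x
    using assms(1) unfolding positive_classical_solution_def holder2_circle_def
    by (auto simp: DERIV_deriv_iff_real_differentiable algebra_simps)
  show "support_ode u (deriv u) (\<lambda>x. f x * u x powr (p - 1)) {}"
  proof
    show "continuous_on UNIV u" "continuous_on UNIV (deriv u)"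
      using d d2 DERIV_isCont by (blast intro: continuous_at_imp_continuous_on)+
    show "0 \<le> f x * u x powr (p - 1)" for x
      using assms(2)[of x] by simp
    show "(deriv u has_real_derivative f x * u x powr (p - 1) - u x) (at x)" for x
      using d2[of x] eq[of x] by simp
  qed (use d in auto)
  show "circle_fun u" "\<And>x. u x > 0"
    using assms(1) unfolding positive_classical_solution_def holder2_circle_def by auto
qed

text \<open>The threshold is the positive zero of G(x) = x^2/2 - M x^p/p: beyond it, G exceeds all
  its earlier values. If u(x0) lay beyond it, the next critical point x1 would have u(x1) < u(x0)
  and hence a smaller G, whereas the energy \<open>H\<close>, which equals G(u) at critical points,
  does not decrease from x0 to x1.\<close>

lemma solution_max_le:
  fixes p M :: real
  assumes sol: "positive_classical_solution p \<alpha> f u" and fpos: "\<And>x. f x > 0"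
    and p: "0 < p" "p < 2" and M: "\<And>x. f x \<le> M" and max: "\<And>t. u t \<le> u x0"
  shows "u x0 powr (2 - p) \<le> 2 * M / p"
proof (rule ccontr)
  interpret support_ode u "deriv u" "\<lambda>x. f x * u x powr (p - 1)" "{}"
    by (rule pos_solution_support_ode[OF sol fpos])
  note per = pos_solution_support_ode(2)[OF sol fpos] and upos = pos_solution_support_ode(3)[OF sol fpos]
  define G where "G x = x\<^sup>2 / 2 - M * x powr p / p" for x
  assume "\<not> ?thesis"
  then have big: "u x0 powr (2 - p) > 2 * M / p" by simp
  have G_fact: "G x = x powr p * (x powr (2 - p) / 2 - M / p)" if "x > 0" for x
    using that by (simp add: G_def algebra_simps flip: powr_add)
  have G_less: "G x < G (u x0)" if "0 < x" "x < u x0" for x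
  proof -
    have "x powr p < u x0 powr p" "x powr (2 - p) < u x0 powr (2 - p)"
      using that p by (auto intro!: powr_less_mono2)
    moreover have "0 < u x0 powr (2 - p) / 2 - M / p" using big by (simp add: mult.commute)
    moreover have "0 \<le> x powr p" by simp
    ultimately have "x powr p * (x powr (2 - p) / 2 - M / p) < u x0 powr p * (u x0 powr (2 - p) / 2 - M / p)"
      by (smt (verit) divide_less_cancel mult_less_cancel_right mult_left_mono)
    then show ?thesis using that upos by (simp add: G_fact)
  qed
  have d: "(u has_real_derivative deriv u x) (at x)"
    and d2: "(deriv u has_real_derivative f x * u x powr (p - 1) - u x) (at x)" for x
    using deriv_u deriv_u1 by auto
  have crit: "deriv u x0 = 0"
    by (rule DERIV_local_max[OF d, of 1]) (use max in auto)
  \<comment> \<open>Strict negativity makes \<open>deriv u\<close> negative immediately to the right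
    of \<open>x0\<close>. It follows from M < 2M/p, which uses p < 2.\<close>
  have "deriv (deriv u) x0 < 0"
  proof -
    have "f x0 * u x0 powr (p - 1) \<le> M * u x0 powr (p - 1)"
      using M by (simp add: mult_right_mono)
    also have "\<dots> < u x0"
    proof -
      have "M > 0" using M[of 0] fpos[of 0] by linarith
      then have "M < 2 * M / p" using p by (simp add: field_simps)
      then have "M * u x0 powr (p - 1) < u x0 powr (2 - p) * u x0 powr (p - 1)"
        using big upos[of x0] by (intro mult_strict_right_mono) auto
      also have "\<dots> = u x0" using upos[of x0] by (simp flip: powr_add)
      finally show ?thesis .
    qed
    finally show ?thesis using d2[of x0] by (simp add: DERIV_imp_deriv)
  qed
  then obtain e where e: "e > 0" "\<And>h. 0 < h \<Longrightarrow> h < e \<Longrightarrow> deriv u (x0 + h) < 0"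
    using DERIV_neg_dec_right[OF d2[of x0]] d2[of x0] crit by (auto simp: DERIV_imp_deriv)
  \<comment> \<open>The cutoff lies inside the interval where \<open>deriv u\<close> is negative, so
    \<open>Inf Z\<close> is a critical point different from \<open>x0\<close>. The minimum with 1
    keeps the cutoff below \<open>x0 + 2 * pi\<close>, which is again a maximum point and makes
    \<open>Z\<close> nonempty.\<close>
  define Z where "Z = {x. x0 + min e 1 / 2 \<le> x \<and> deriv u x = 0}"
  have "deriv u (x0 + 2 * pi) = 0"
    by (rule DERIV_local_max[OF d, of 1]) (use max circle_fun_shift[OF per] in auto)
  then have ne: "Z \<noteq> {}" using pi_gt3 by (auto simp: Z_def intro!: exI[of _ "x0 + 2 * pi"])
  have "closed Z"
  proof -
    have "Z = {x0 + min e 1 / 2..} \<inter> deriv u -` {0}" by (auto simp: Z_def)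
    moreover have "closed (deriv u -` {0})"
      using cont_u1 by (intro continuous_closed_vimage) (auto simp: continuous_on_eq_continuous_at)
    ultimately show ?thesis by (simp add: closed_Int)
  qed
  moreover have bdd: "bdd_below Z" by (auto simp: Z_def bdd_below_def)
  ultimately have inZ: "Inf Z \<in> Z" using ne by (intro closed_contains_Inf)
  define x1 where "x1 = Inf Z"
  have x1: "x0 < x1" "deriv u x1 = 0"
    using inZ e(1) by (auto simp: Z_def x1_def)
  have neg: "deriv u x < 0" if "x0 < x" "x < x1" for x
  proof (rule ccontr)
    assume "\<not> deriv u x < 0"
    then have ge: "deriv u x \<ge> 0" by simp
    define a where "a = x0 + min e 1 / 2"
    have a: "deriv u a < 0" using e by (auto simp: a_def)
    have "x0 + e \<le> x" using e(2)[of "x - x0"] ge that by force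
    then have "a \<le> x" using e(1) by (auto simp: a_def)
    then obtain z where "a \<le> z" "z \<le> x" "deriv u z = 0"
      using IVT'[of "deriv u" a 0 x] a ge continuous_on_subset[OF cont_u1] by auto
    then have "z \<in> Z" by (simp add: Z_def a_def)
    then have "x1 \<le> z" unfolding x1_def using bdd by (rule cInf_lower)
    then show False using \<open>z \<le> x\<close> that by simp
  qed
  \<comment> \<open>By the equation, H' = u' (f - M) u^(p-1). Between \<open>x0\<close> and
    \<open>x1\<close> both u' and f - M are nonpositive.\<close>
  define H where "H x = (deriv u x)\<^sup>2 / 2 + G (u x)" for x
  have "(H has_real_derivative deriv u x * ((f x - M) * u x powr (p - 1))) (at x)" for x
    unfolding H_def G_def
    by (rule derivative_eq_intros d d2 refl DERIV_powr | use upos[of x] p in force)+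
      (use upos[of x] p in \<open>simp add: field_simps power2_eq_square\<close>)
  then have "H x0 \<le> H x1"
  proof (intro DERIV_nonneg_imp_nondecreasing[OF less_imp_le[OF x1(1)]])
    fix x assume "x0 \<le> x" "x \<le> x1"
    then have "deriv u x \<le> 0" using neg[of x] crit x1(2) by force
    moreover have "(f x - M) * u x powr (p - 1) \<le> 0" using M[of x] by (simp add: mult_le_0_iff)
    ultimately show "\<exists>y. (H has_real_derivative y) (at x) \<and> 0 \<le> y"
      using \<open>\<And>x. (H has_real_derivative _ x) (at x)\<close> mult_nonpos_nonpos by blast
  qed
  moreover have "u x1 < u x0"
    by (rule DERIV_neg_imp_decreasing_open[where f = u, OF x1(1)])
      (use d neg continuous_on_subset[OF cont_u] in auto)
  ultimately show False
    using G_less[of "u x1"] upos[of x1] crit x1(2) by (simp add: H_def)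
qed

text \<open>If the bound failed, then f > u^(2-p) at \<open>x0\<close>, which says u'' > 0 there.
  Since u' vanishes at \<open>x0\<close>, it would be positive just after, and \<open>u\<close>
  would rise above its maximum.\<close>

lemma solution_max_ge:
  assumes sol: "positive_classical_solution p \<alpha> f u" and fpos: "\<And>x. f x > 0"
    and m: "\<And>x. m \<le> f x" and max: "\<And>t. u t \<le> u x0"
  shows "m \<le> u x0 powr (2 - p)"
proof (rule ccontr)
  interpret support_ode u "deriv u" "\<lambda>x. f x * u x powr (p - 1)" "{}"
    by (rule pos_solution_support_ode[OF sol fpos])
  note upos = pos_solution_support_ode(3)[OF sol fpos]
  assume "\<not> ?thesis"
  then have "u x0 powr (2 - p) < f x0" using m[of x0] by simp
  then have "u x0 powr (2 - p) * u x0 powr (p - 1) < f x0 * u x0 powr (p - 1)"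
    using upos[of x0] by (intro mult_strict_right_mono) auto
  then have l: "0 < f x0 * u x0 powr (p - 1) - u x0"
    using upos[of x0] by (simp flip: powr_add)
  have crit: "deriv u x0 = 0"
    by (rule DERIV_local_max[OF deriv_u, of x0 1]) (use max in auto)
  obtain e where e: "e > 0" "\<And>h. 0 < h \<Longrightarrow> h < e \<Longrightarrow> deriv u (x0 + h) > 0"
    using DERIV_pos_inc_right[OF deriv_u1[of x0] l] crit by auto
  have "u x0 < u (x0 + e / 2)"
  proof (rule DERIV_pos_imp_increasing_open[where f = u])
    fix x assume "x0 < x" "x < x0 + e / 2"
    then show "\<exists>y. (u has_real_derivative y) (at x) \<and> 0 < y"
      using deriv_u[of x] e(2)[of "x - x0"] e(1) by (auto intro!: exI[of _ "deriv u x"])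
  qed (use e continuous_on_subset[OF cont_u] in auto)
  then show False using max[of "x0 + e / 2"] by simp
qed

text \<open>Within \<pi>/3 of a maximum point the cosine is at least 1/2, hence u is at least half
  its maximum there. The second factor 1/2 is the minimum of sin(s - \<theta>) for s - \<theta> in
  [\<pi>/6, 5\<pi>/6], and \<pi>/6 is the length of an arc on which both bounds hold.\<close>

lemma solution_width_ge:
  assumes sol: "positive_classical_solution p \<alpha> f u" and fpos: "\<And>x. f x > 0" and p: "0 < p"
    and m: "\<And>x. m \<le> f x" "0 < m" and max: "\<And>t. u t \<le> u x0"
  shows "m * ((u x0 / 2) powr p / u x0) / 2 * (pi / 6) \<le> u \<theta> + u (\<theta> + pi)"
proof -
  interpret support_ode u "deriv u" "\<lambda>x. f x * u x powr (p - 1)" "{}"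
    by (rule pos_solution_support_ode[OF sol fpos])
  note per = pos_solution_support_ode(2)[OF sol fpos] and upos = pos_solution_support_ode(3)[OF sol fpos]
  define c where "c = m * ((u x0 / 2) powr p / u x0)"
  \<comment> \<open>Stated for arbitrary \<open>y\<close> and \<theta>: the maximum point is first
    moved into the period starting at \<theta>, and the base angle may then have to be replaced by
    \<theta> + \<pi>.\<close>
  have main: "c / 2 * (pi / 6) \<le> u \<theta> + u (\<theta> + pi)"
    if max: "\<And>t. u t \<le> u y" and uy: "u y = u x0" and y: "\<theta> \<le> y" "y \<le> \<theta> + pi" for y \<theta>
  proof -
    have crit: "deriv u y = 0"
      by (rule DERIV_local_max[OF deriv_u, of y 1]) (use max in auto)
    have F: "c \<le> f s * u s powr (p - 1)" if "\<bar>s - y\<bar> \<le> pi / 3" for s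
    proof -
      have "cos (pi / 3) \<le> cos \<bar>s - y\<bar>"
        by (rule cos_monotone_0_pi_le) (use that pi_gt_zero in linarith)+
      then have "u y * (1 / 2) \<le> u y * cos (s - y)"
        using upos[of y] by (simp add: cos_60)
      also have "\<dots> \<le> u s"
        using above_tangent_circle[of s y] crit that pi_gt_zero by force
      finally have "(u x0 / 2) powr p \<le> u s powr p"
        using upos[of x0] uy p by (intro powr_mono2) auto
      \<comment> \<open>Writing u^(p-1) as u^p / u avoids a distinction by the sign of p - 1: the
        numerator is bounded below and the denominator above.\<close>
      then have "(u x0 / 2) powr p / u x0 \<le> u s powr p / u s"
        using upos[of x0] upos[of s] max[of s] uy by (intro frac_le) auto
      also have "\<dots> = u s powr (p - 1)" using upos[of s] by (simp add: powr_diff)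
      finally show ?thesis
        unfolding c_def using m(1)[of s] m(2) upos[of x0] by (intro mult_mono) auto
    qed
    have "c > 0" using m(2) upos[of x0] by (simp add: c_def)
    have FS: "c / 2 \<le> f s * u s powr (p - 1) * sin (s - \<theta>)"
      if "\<bar>s - y\<bar> \<le> pi / 3" "\<theta> + pi / 6 \<le> s" "s \<le> \<theta> + 5 * pi / 6" for s
    proof -
      have "1 / 2 \<le> sin (s - \<theta>)"
      proof -
        have "cos (pi / 3) \<le> cos \<bar>s - \<theta> - pi / 2\<bar>"
          by (rule cos_monotone_0_pi_le) (use that pi_gt_zero in linarith)+
        also have "\<dots> = sin (s - \<theta>)"
          by (simp add: cos_diff)
        finally show ?thesis by (simp add: cos_60)
      qed
      then have "c * (1 / 2) \<le> f s * u s powr (p - 1) * sin (s - \<theta>)"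
        using F[OF that(1)] \<open>c > 0\<close> by (intro mult_mono) auto
      then show ?thesis by simp
    qed
    show ?thesis
    \<comment> \<open>The arc is taken on the side of \<open>y\<close> that points towards the
      middle of the half circle, so that it stays inside
      [\<theta> + \<pi>/6, \<theta> + 5\<pi>/6].\<close>
    proof (cases "y \<le> \<theta> + pi / 2")
      case True
      have "c / 2 * ((y + pi / 3) - (y + pi / 6)) \<le> u \<theta> + u (\<theta> + pi)"
        by (rule width_ge, (use True y pi_gt_zero in linarith)+, rule FS)
          (use True y pi_gt_zero in auto)
      then show ?thesis by simp
    next
      case False
      have "c / 2 * ((y - pi / 6) - (y - pi / 3)) \<le> u \<theta> + u (\<theta> + pi)"
        by (rule width_ge, (use False y pi_gt_zero in linarith)+, rule FS)
          (use False y pi_gt_zero in auto)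
      then show ?thesis by simp
    qed
  qed
  obtain y where y: "y \<in> {\<theta>..<\<theta> + 2 * pi}" "u y = u x0"
    using circle_fun_translate[of \<theta> x0] per by metis
  show ?thesis
  proof (cases "y \<le> \<theta> + pi")
    case True
    then show ?thesis using main[of y \<theta>] y max unfolding c_def by auto
  next
    \<comment> \<open>The width has period \<pi>, and \<open>y\<close> lies in the half circle that
      starts at \<theta> + \<pi>.\<close>
    case False
    then have "c / 2 * (pi / 6) \<le> u (\<theta> + pi) + u (\<theta> + pi + pi)"
      using main[of y "\<theta> + pi"] y max by auto
    moreover have "u (\<theta> + pi + pi) = u \<theta>"
      using circle_fun_shift[OF per, of \<theta>] by (simp add: algebra_simps)
    ultimately show ?thesis unfolding c_def by simp
  qed
qed

text \<open>The maximum of \<open>u\<close> lies between \<open>r\<close> and \<open>R\<close>, so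
  all widths lie between \<open>w\<close> and \<open>2 * R\<close>. These numbers are built from p
  and the extreme values of \<open>f\<close> alone, so one \<open>C\<close> serves every \<alpha>
  and \<open>u\<close>.\<close>

lemma width_bounds:
  fixes p :: real
  assumes p: "0 < p" "p < 2" and fpos: "\<And>\<theta>. f \<theta> > 0"
    and f: "circle_fun f" "continuous_on UNIV f"
  shows "\<exists>C\<ge>1. \<forall>\<alpha> u. positive_classical_solution p \<alpha> f u \<longrightarrow>
      inverse C \<le> min_width u \<and> min_width u \<le> max_width u \<and> max_width u \<le> C"
proof -
  obtain a where a: "\<And>t. f t \<le> f a" using circle_fun_attains_sup[OF f] by blast
  obtain b where b: "\<And>t. f b \<le> f t" using circle_fun_attains_inf[OF f] by blast
  define R where "R = (2 * f a / p) powr (1 / (2 - p))"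
  define r where "r = f b powr (1 / (2 - p))"
  define w where "w = f b * ((r / 2) powr p / R) / 2 * (pi / 6)"
  define C where "C = Max {1, 2 * R, inverse w}"
  have C: "1 \<le> C" "2 * R \<le> C" "inverse w \<le> C" by (auto simp: C_def)
  have pos: "R > 0" "r > 0" using fpos[of a] fpos[of b] p by (auto simp: R_def r_def)
  then have "w > 0" using fpos[of b] by (simp add: w_def)
  then have Cw: "inverse C \<le> w"
    using C(1,3) by (metis inverse_inverse_eq le_imp_inverse_le positive_imp_inverse_positive)
  have "inverse C \<le> min_width u \<and> min_width u \<le> max_width u \<and> max_width u \<le> C"
    if sol: "positive_classical_solution p \<alpha> f u" for \<alpha> u
  proof -
    interpret support_ode u "deriv u" "\<lambda>x. f x * u x powr (p - 1)" "{}"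
      by (rule pos_solution_support_ode[OF sol fpos])
    note per = pos_solution_support_ode(2)[OF sol fpos] and upos = pos_solution_support_ode(3)[OF sol fpos]
    note wb = width_bounds_attained[OF per cont_u]
    obtain x0 where max: "\<And>t. u t \<le> u x0" using circle_fun_attains_sup[OF per cont_u] by blast
    have cancel: "u x0 = (u x0 powr (2 - p)) powr (1 / (2 - p))"
      using upos[of x0] p by (simp add: powr_powr)
    have "u x0 \<le> R"
      by (subst cancel) (use solution_max_le[OF sol fpos p a max] p in \<open>auto simp: R_def intro!: powr_mono2\<close>)
    moreover have "r \<le> u x0"
      by (subst cancel) (use solution_max_ge[OF sol fpos b max] p fpos[of b] in \<open>auto simp: r_def intro!: powr_mono2\<close>)
    \<comment> \<open>The lower bound \<open>r\<close> enters the numerator and the upper bound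
      \<open>R\<close> the denominator, again without regard to the sign of p - 1.\<close>
    ultimately have "(r / 2) powr p / R \<le> (u x0 / 2) powr p / u x0"
      using pos p by (intro frac_le powr_mono2) auto
    then have "w \<le> f b * ((u x0 / 2) powr p / u x0) / 2 * (pi / 6)"
      unfolding w_def using fpos[of b] by (intro mult_right_mono divide_right_mono mult_left_mono) auto
    then have wle: "w \<le> u \<theta> + u (\<theta> + pi)" for \<theta>
      using solution_width_ge[OF sol fpos p(1) b fpos max, of \<theta>] by linarith
    obtain s where s: "min_width u = u s + u (s + pi)" using wb(1) by blast
    obtain t where t: "max_width u = u t + u (t + pi)" using wb(2) by blast
    have "inverse C \<le> min_width u" using wle[of s] Cw s by simp
    moreover have "max_width u \<le> C"
      using max[of t] max[of "t + pi"] \<open>u x0 \<le> R\<close> C(2) t by linarith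
    moreover have "min_width u \<le> max_width u"
      using wb(3)[of 0] wb(4)[of 0] by linarith
    ultimately show ?thesis by blast
  qed
  then show ?thesis using C(1) by blast
qed

section \<open>From the equation to convex bodies and distributions\<close>

lemma norm_circle_vector: "norm (vector [cos \<theta>, sin \<theta>] :: real ^ 2) = 1"
  by (simp add: norm_eq_1 inner_vec_def sum_2 flip: power2_eq_square)

context support_ode
begin

text \<open>The body is the intersection of the half-planes prescribed by \<open>u\<close>. That
  each of them is touched follows from \<open>above_tangent_circle\<close>; the assumption
  \<open>ball\<close> puts a disc with centre (v, w) and radius \<epsilon> inside the body.\<close>

lemma convex_body_support_function:
  assumes per: "circle_fun u"
    and ball: "\<And>\<theta>. v * cos \<theta> + w * sin \<theta> + \<epsilon> \<le> u \<theta>" and "\<epsilon> > 0"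
  shows "\<exists>\<Omega>. convex_body \<Omega> \<and> (\<forall>\<theta>. u \<theta> = support_function \<Omega> \<theta>)"
proof -
  define e where "e \<theta> = (vector [cos \<theta>, sin \<theta>] :: real ^ 2)" for \<theta>
  define \<Omega> where "\<Omega> = (\<Inter>\<theta>. {x. e \<theta> \<bullet> x \<le> u \<theta>})"
  have e_inner: "e \<theta> \<bullet> x = x $ 1 * cos \<theta> + x $ 2 * sin \<theta>" for \<theta> x
    by (simp add: e_def inner_vec_def sum_2)
  have in_\<Omega>: "x \<in> \<Omega> \<longleftrightarrow> (\<forall>\<theta>. x $ 1 * cos \<theta> + x $ 2 * sin \<theta> \<le> u \<theta>)" for x
    by (simp add: \<Omega>_def e_inner)
  have "convex \<Omega>" "closed \<Omega>"
    unfolding \<Omega>_def by (auto intro!: convex_INT convex_halfspace_le closed_halfspace_le)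
  moreover have "bounded \<Omega>"
  proof -
    have "norm x \<le> \<bar>u 0\<bar> + \<bar>u pi\<bar> + \<bar>u (pi / 2)\<bar> + \<bar>u (- pi / 2)\<bar>" if "x \<in> \<Omega>" for x
    proof -
      have "x $ 1 \<le> u 0" "- x $ 1 \<le> u pi" "x $ 2 \<le> u (pi / 2)" "- x $ 2 \<le> u (- pi / 2)"
        using that[unfolded in_\<Omega>, rule_format, of 0] that[unfolded in_\<Omega>, rule_format, of pi]
          that[unfolded in_\<Omega>, rule_format, of "pi / 2"] that[unfolded in_\<Omega>, rule_format, of "- pi / 2"]
        by simp_all
      moreover have "norm x \<le> \<bar>x $ 1\<bar> + \<bar>x $ 2\<bar>"
        using norm_le_l1_cart[of x] by (simp add: sum_2)
      ultimately show ?thesis by linarith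
    qed
    then show ?thesis by (auto simp: bounded_iff)
  qed
  moreover have "interior \<Omega> \<noteq> {}"
  proof -
    define c where "c = (vector [v, w] :: real ^ 2)"
    have "ball c \<epsilon> \<subseteq> \<Omega>"
    proof
      fix y assume "y \<in> ball c \<epsilon>"
      then have y: "norm (y - c) < \<epsilon>" by (simp add: dist_norm norm_minus_commute)
      have "e \<theta> \<bullet> y \<le> u \<theta>" for \<theta>
      proof -
        have "e \<theta> \<bullet> y = e \<theta> \<bullet> c + e \<theta> \<bullet> (y - c)" by (simp add: inner_diff_right)
        also have "e \<theta> \<bullet> c = v * cos \<theta> + w * sin \<theta>" by (simp add: e_inner c_def)
        also have "e \<theta> \<bullet> (y - c) \<le> norm (e \<theta>) * norm (y - c)" by (rule norm_cauchy_schwarz)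
        also have "\<dots> < \<epsilon>" using y by (simp add: e_def norm_circle_vector)
        finally show ?thesis using ball[of \<theta>] by simp
      qed
      then show "y \<in> \<Omega>" by (simp add: \<Omega>_def)
    qed
    then show ?thesis
      using \<open>\<epsilon> > 0\<close> interior_maximal[OF _ open_ball] by (metis centre_in_ball empty_iff subset_iff)
  qed
  ultimately have "convex_body \<Omega>" by (simp add: convex_body_def compact_eq_bounded_closed)
  moreover have "u \<theta> = support_function \<Omega> \<theta>" for \<theta>
  proof -
    \<comment> \<open>The expected contact point: u times the unit normal at \<theta> plus
      \<open>u1\<close> times its rotation by a right angle.\<close>
    define x where "x = (vector [u \<theta> * cos \<theta> - u1 \<theta> * sin \<theta>, u \<theta> * sin \<theta> + u1 \<theta> * cos \<theta>] :: real ^ 2)"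
    have x: "e \<phi> \<bullet> x = u \<theta> * cos (\<phi> - \<theta>) + u1 \<theta> * sin (\<phi> - \<theta>)" for \<phi>
      by (simp add: e_inner x_def cos_diff sin_diff algebra_simps)
    have "e \<phi> \<bullet> x \<le> u \<phi>" for \<phi>
    proof -
      \<comment> \<open>The comparison is available only up to distance \<pi> from \<theta>, so the
        angle is moved into that range.\<close>
      obtain t where t: "t \<in> {\<theta> - pi..<\<theta> - pi + 2 * pi}" "\<And>v. circle_fun v \<Longrightarrow> v t = v \<phi>"
        using circle_fun_translate[of "\<theta> - pi" \<phi>] by metis
      have "cos t = cos \<phi>" "sin t = sin \<phi>"
        using t(2)[of cos] t(2)[of sin] by (simp_all add: periodic_fun_simple_def)
      then have "e \<phi> \<bullet> x = e t \<bullet> x" by (simp add: e_def)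
      also have "\<dots> \<le> u t" unfolding x by (rule above_tangent_circle) (use t(1) in auto)
      finally show ?thesis using t(2)[OF per] by simp
    qed
    then have "x \<in> \<Omega>" by (simp add: \<Omega>_def)
    have "(SUP y\<in>\<Omega>. y \<bullet> e \<theta>) = u \<theta>"
    proof (rule cSup_eq_maximum)
      have "x \<bullet> e \<theta> = u \<theta>" using x[of \<theta>] by (simp add: inner_commute)
      then show "u \<theta> \<in> (\<lambda>y. y \<bullet> e \<theta>) ` \<Omega>" using \<open>x \<in> \<Omega>\<close> by force
    qed (auto simp: \<Omega>_def inner_commute)
    then show ?thesis by (simp add: support_function_def e_def)
  qed
  ultimately show ?thesis by blast
qed

text \<open>F may blow up at exceptional points. The fundamental theorem applied to
  \<open>u1\<close> gives gauge integrability of F - u; adding \<open>u\<close> and using the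
  nonnegativity of F turns this into Lebesgue integrability.\<close>

lemma set_integrable_rhs:
  assumes F: "F \<in> borel_measurable borel" and ab: "a \<le> b"
  shows "set_integrable lborel {a..b} F"
proof -
  have "((\<lambda>x. F x - u x) has_integral u1 b - u1 a) {a..b}"
  proof (rule fundamental_theorem_of_calculus_strong[OF finite_S[of a b] ab])
    show "(u1 has_vector_derivative F x - u x) (at x)" if "x \<in> {a..b} - S \<inter> {a..b}" for x
      using deriv_u1[of x] that by (auto simp: has_real_derivative_iff_has_vector_derivative)
  qed (rule continuous_on_subset[OF cont_u1]; simp)
  moreover have "u integrable_on {a..b}"
    by (rule integrable_continuous_real[OF continuous_on_subset[OF cont_u]]) simp
  ultimately have "((\<lambda>x. (F x - u x) + u x) has_integral u1 b - u1 a + integral {a..b} u) {a..b}"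
    by (intro has_integral_add) auto
  then have "(F has_integral u1 b - u1 a + integral {a..b} u) {a..b}" by simp
  from nn_integral_has_integral_lebesgue[OF _ this] F_nonneg
  have "(\<integral>\<^sup>+x. ennreal (indicator {a..b} x * F x) \<partial>lborel) < \<infinity>" by simp
  then show ?thesis
    unfolding set_integrable_def using F F_nonneg by (intro integrableI_nonneg) auto
qed

text \<open>Integration by parts in one stroke: u \<phi>' - u1 \<phi> has derivative u (\<phi>'' +
  \<phi>) - F \<phi> off \<open>S\<close>, and its values at 0 and 2\<pi> agree by periodicity. The
  separate integrability of F \<phi> allows the integral of the difference to be split.\<close>

lemma distributional_equation:
  assumes F: "F \<in> borel_measurable borel" and per: "circle_fun u" "circle_fun u1"
    and \<phi>: "circle_test_function \<phi>"
  shows "set_integrable lborel {0..2 * pi} (\<lambda>x. F x * \<phi> x)"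
    and "(LINT x:{0..2 * pi}|lborel. u x * (deriv (deriv \<phi>) x + \<phi> x)) =
      (LINT x:{0..2 * pi}|lborel. F x * \<phi> x)"
proof -
  have diff: "(deriv ^^ n) \<phi> differentiable (at x)" and per\<phi>: "circle_fun \<phi>" for n x
    using \<phi> by (auto simp: circle_test_function_def)
  have d: "(\<phi> has_real_derivative deriv \<phi> x) (at x)"
      "(deriv \<phi> has_real_derivative deriv (deriv \<phi>) x) (at x)"
      "(deriv (deriv \<phi>) has_real_derivative deriv (deriv (deriv \<phi>)) x) (at x)" for x
    using diff[of 0 x] diff[of 1 x] diff[of 2 x]
    by (simp_all add: DERIV_deriv_iff_real_differentiable numeral_2_eq_2)
  have cont: "continuous_on A \<phi>" "continuous_on A (deriv \<phi>)" "continuous_on A (deriv (deriv \<phi>))" for A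
    using d DERIV_isCont by (blast intro: continuous_at_imp_continuous_on)+
  have cont_u': "continuous_on A u" "continuous_on A u1" for A
    using cont_u cont_u1 continuous_on_subset by blast+
  have per_deriv: "deriv \<phi> (2 * pi) = deriv \<phi> 0"
  proof -
    have "((\<lambda>x. \<phi> (x + 2 * pi)) has_real_derivative deriv \<phi> (2 * pi)) (at 0)"
      using d(1)[of "2 * pi"] DERIV_shift[of \<phi> _ 0 "2 * pi"] by simp
    then have "(\<phi> has_real_derivative deriv \<phi> (2 * pi)) (at 0)"
      using circle_fun_shift[OF per\<phi>] by simp
    then show ?thesis by (simp add: DERIV_imp_deriv)
  qed
  have end_eq: "u (2 * pi) = u 0" "u1 (2 * pi) = u1 0" "\<phi> (2 * pi) = \<phi> 0"
    using circle_fun_shift[OF per(1), of 0] circle_fun_shift[OF per(2), of 0]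
      circle_fun_shift[OF per\<phi>, of 0] by simp_all
  have [measurable]: "\<phi> \<in> borel_measurable borel" "F \<in> borel_measurable borel"
    using cont F by (auto intro: borel_measurable_continuous_onI)
  show intF: "set_integrable lborel {0..2 * pi} (\<lambda>x. F x * \<phi> x)"
  proof -
    obtain B where B: "\<And>x. x \<in> {0..2 * pi} \<Longrightarrow> \<bar>\<phi> x\<bar> \<le> B"
      using compact_imp_bounded[OF compact_continuous_image[OF cont(1) compact_Icc[of 0 "2 * pi"]]]
      by (fastforce simp: bounded_iff)
    have "set_integrable lborel {0..2 * pi} (\<lambda>x. B * F x)"
      using set_integrable_rhs[OF F, of 0 "2 * pi"] by simp
    then show ?thesis
    proof (rule set_integrable_bound)
      show "AE x in lborel. x \<in> {0..2 * pi} \<longrightarrow> norm (F x * \<phi> x) \<le> norm (B * F x)"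
      proof (intro AE_I2 impI)
        fix x assume "x \<in> {0..2 * pi}"
        then have "F x * \<bar>\<phi> x\<bar> \<le> F x * B" "0 \<le> B"
          using B[of x] F_nonneg[of x] by (auto intro: mult_left_mono)
        then show "norm (F x * \<phi> x) \<le> norm (B * F x)"
          using F_nonneg[of x] by (simp add: abs_mult mult.commute)
      qed
    qed (simp add: set_borel_measurable_def)
  qed
  have int_u: "set_integrable lborel {0..2 * pi} (\<lambda>x. u x * (deriv (deriv \<phi>) x + \<phi> x))"
    by (intro borel_integrable_atLeastAtMost' continuous_intros cont cont_u')
  have "((\<lambda>x. u x * (deriv (deriv \<phi>) x + \<phi> x) - F x * \<phi> x) has_integral
      (u (2 * pi) * deriv \<phi> (2 * pi) - u1 (2 * pi) * \<phi> (2 * pi)) - (u 0 * deriv \<phi> 0 - u1 0 * \<phi> 0)) {0..2 * pi}"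
  proof (rule fundamental_theorem_of_calculus_strong[OF finite_S[of 0 "2 * pi"]])
    fix x assume "x \<in> {0..2 * pi} - S \<inter> {0..2 * pi}"
    then have x: "x \<notin> S" by auto
    show "((\<lambda>x. u x * deriv \<phi> x - u1 x * \<phi> x) has_vector_derivative
        u x * (deriv (deriv \<phi>) x + \<phi> x) - F x * \<phi> x) (at x)"
      unfolding has_real_derivative_iff_has_vector_derivative[symmetric]
      by (rule derivative_eq_intros deriv_u[OF x] deriv_u1[OF x] d refl)+ (simp add: algebra_simps)
  qed (auto intro!: continuous_intros cont cont_u')
  then have "integral {0..2 * pi} (\<lambda>x. u x * (deriv (deriv \<phi>) x + \<phi> x) - F x * \<phi> x) = 0"
    using end_eq per_deriv by (simp add: integral_unique)
  then show "(LINT x:{0..2 * pi}|lborel. u x * (deriv (deriv \<phi>) x + \<phi> x)) =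
      (LINT x:{0..2 * pi}|lborel. F x * \<phi> x)"
    using set_borel_integral_eq_integral[OF int_u] set_borel_integral_eq_integral[OF intF]
    by (simp add: integral_diff)
qed

end

lemma enn2real_ext_powr:
  "enn2real (ext_powr t q) = (if t = 0 \<and> q = 0 then 1 else t powr q)"
  by (auto simp: ext_powr_def)

text \<open>\<open>powr\<close> and \<open>ext_powr\<close> can disagree only at zeros of
  \<open>u\<close>. These lie in \<open>S\<close>, which is null on the period, so both integrals
  can be computed with F.\<close>

lemma (in support_ode) generalized_solution:
  assumes per: "circle_fun u" "circle_fun u1"
    and f: "continuous_on UNIV f" "\<And>x. f x > 0"
    and F: "\<And>x. F x = f x * u x powr (p - 1)"
    and u: "\<And>x. 0 \<le> u x" "\<And>x. x \<notin> S \<Longrightarrow> u x \<noteq> 0"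
    and ball: "\<And>\<theta>. v * cos \<theta> + w * sin \<theta> + \<epsilon> \<le> u \<theta>" "\<epsilon> > 0"
  shows "nonneg_generalized_solution p f u"
  unfolding nonneg_generalized_solution_def
proof (intro conjI allI impI)
  have [measurable]: "u \<in> borel_measurable borel" "f \<in> borel_measurable borel"
    using cont_u f(1) by (auto intro: borel_measurable_continuous_onI)
  have F_eq: "F = (\<lambda>x. f x * u x powr (p - 1))" using F by auto
  then have Fm[measurable]: "F \<in> borel_measurable borel" by simp
  have "S \<inter> {0..2 * pi} \<in> null_sets lborel"
    by (rule finite_imp_null_set_lborel[OF finite_S])
  then have AE: "AE x in lborel. x \<in> {0..2 * pi} \<longrightarrow> u x \<noteq> 0"
    by (rule AE_mp[OF AE_not_in]) (use u(2) in auto)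
  have "(\<integral>\<^sup>+\<theta>\<in>{0..2 * pi}. ennreal (f \<theta>) * ext_powr (u \<theta>) (p - 1) \<partial>lborel) =
      (\<integral>\<^sup>+\<theta>. ennreal (indicator {0..2 * pi} \<theta> * F \<theta>) \<partial>lborel)"
  proof (rule nn_integral_cong_AE, use AE in eventually_elim)
    fix x assume "x \<in> {0..2 * pi} \<longrightarrow> u x \<noteq> 0"
    then show "ennreal (f x) * ext_powr (u x) (p - 1) * indicator {0..2 * pi} x =
        ennreal (indicator {0..2 * pi} x * F x)"
      using f(2)[of x] by (auto simp: ext_powr_def F ennreal_mult' split: split_indicator)
  qed
  also have "\<dots> < \<infinity>"
    using set_integrable_rhs[OF Fm, of 0 "2 * pi"] F_nonneg
    by (simp add: set_integrable_def integrable_iff_bounded)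
  finally show "(\<integral>\<^sup>+\<theta>\<in>{0..2 * pi}. ennreal (f \<theta>) * ext_powr (u \<theta>) (p - 1) \<partial>lborel) < \<infinity>" .
  fix \<phi> assume \<phi>: "circle_test_function \<phi>"
  then have "\<phi> differentiable (at x)" for x
    unfolding circle_test_function_def by (metis funpow_0)
  then have "continuous_on UNIV \<phi>"
    by (auto intro!: continuous_at_imp_continuous_on differentiable_imp_continuous_within)
  then have [measurable]: "\<phi> \<in> borel_measurable borel" by (rule borel_measurable_continuous_onI)
  have "(LINT x:{0..2 * pi}|lborel. F x * \<phi> x) =
      (LINT x:{0..2 * pi}|lborel. f x * enn2real (ext_powr (u x) (p - 1)) * \<phi> x)"
    unfolding set_lebesgue_integral_def
  proof (rule integral_cong_AE)
    show "AE x in lborel. indicat_real {0..2 * pi} x *\<^sub>R (F x * \<phi> x) =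
        indicat_real {0..2 * pi} x *\<^sub>R (f x * enn2real (ext_powr (u x) (p - 1)) * \<phi> x)"
      using AE by eventually_elim (auto simp: enn2real_ext_powr F split: split_indicator)
  qed (unfold enn2real_ext_powr, measurable)
  then show "(LINT x:{0..2 * pi}|lborel. u x * (deriv (deriv \<phi>) x + \<phi> x)) =
      (LINT x:{0..2 * pi}|lborel. f x * enn2real (ext_powr (u x) (p - 1)) * \<phi> x)"
    using distributional_equation(2)[OF Fm per \<phi>] by simp
qed (use per cont_u u convex_body_support_function[OF per(1) ball] in auto)

section \<open>The explicit solution with a zero\<close>

text \<open>For distances d at most 1, the Lipschitz bound suffices because d \<le> d^\<alpha>; for
  larger ones boundedness does, because d^\<alpha> \<ge> 1.\<close>

lemma C1_imp_holder_circle: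
  assumes f: "circle_fun f" "\<And>x. (f has_real_derivative f' x) (at x)"
    and f': "circle_fun f'" "continuous_on UNIV f'" and \<alpha>: "\<alpha> \<in> {0<..<1}"
  shows "holder_circle \<alpha> f"
proof -
  have cont: "continuous_on UNIV f"
    using f(2) DERIV_isCont by (blast intro: continuous_at_imp_continuous_on)
  have "circle_fun (\<lambda>x. \<bar>f x\<bar>)" "circle_fun (\<lambda>x. \<bar>f' x\<bar>)"
    using circle_fun_shift[OF f(1)] circle_fun_shift[OF f'(1)] by (simp_all add: periodic_fun_simple_def)
  then obtain a b where a: "\<And>x. \<bar>f x\<bar> \<le> \<bar>f a\<bar>" and b: "\<And>x. \<bar>f' x\<bar> \<le> \<bar>f' b\<bar>"
    using circle_fun_attains_sup[of "\<lambda>x. \<bar>f x\<bar>"] circle_fun_attains_sup[of "\<lambda>x. \<bar>f' x\<bar>"]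
      continuous_on_rabs[OF cont] continuous_on_rabs[OF f'(2)] by metis
  have lip: "\<bar>f x - f y\<bar> \<le> \<bar>f' b\<bar> * \<bar>x - y\<bar>" for x y
    using field_differentiable_bound[of UNIV f f' "\<bar>f' b\<bar>" x y] f(2) b by simp
  have "\<bar>f x - f y\<bar> \<le> (\<bar>f' b\<bar> + 2 * \<bar>f a\<bar>) * \<bar>x - y\<bar> powr \<alpha>" for x y
  proof (cases "\<bar>x - y\<bar> \<le> 1")
    case True
    have "\<bar>x - y\<bar> \<le> \<bar>x - y\<bar> powr \<alpha>"
      using True \<alpha> powr_mono'[of \<alpha> 1 "\<bar>x - y\<bar>"] by (cases "x = y") auto
    then have "\<bar>f' b\<bar> * \<bar>x - y\<bar> \<le> (\<bar>f' b\<bar> + 2 * \<bar>f a\<bar>) * \<bar>x - y\<bar> powr \<alpha>"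
      by (intro mult_mono) auto
    then show ?thesis using lip[of x y] by linarith
  next
    case False
    then have "(2 * \<bar>f a\<bar>) * 1 \<le> (\<bar>f' b\<bar> + 2 * \<bar>f a\<bar>) * \<bar>x - y\<bar> powr \<alpha>"
      using \<alpha> by (intro mult_mono ge_one_powr_ge_zero) auto
    moreover have "\<bar>f x - f y\<bar> \<le> 2 * \<bar>f a\<bar>" using a[of x] a[of y] by linarith
    ultimately show ?thesis by linarith
  qed
  then show ?thesis using f(1) unfolding holder_circle_def by blast
qed

lemma finite_cos_eq_1: "finite ({x. cos x = 1} \<inter> {a..b :: real})"
proof (rule finite_subset)
  show "{x. cos x = 1} \<inter> {a..b} \<subseteq> (\<lambda>n. of_int n * (2 * pi)) ` {\<lfloor>a / (2 * pi)\<rfloor>..\<lceil>b / (2 * pi)\<rceil>}"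
  proof
    fix x assume "x \<in> {x. cos x = 1} \<inter> {a..b}"
    then obtain n :: int where n: "x = n * 2 * pi" "a \<le> x" "x \<le> b"
      by (auto simp: cos_one_2pi_int)
    then have "a / (2 * pi) \<le> n" "n \<le> b / (2 * pi)" by (simp_all add: field_simps)
    then have "n \<in> {\<lfloor>a / (2 * pi)\<rfloor>..\<lceil>b / (2 * pi)\<rceil>}" by (auto simp: floor_le_iff le_ceiling_iff)
    then show "x \<in> (\<lambda>n. of_int n * (2 * pi)) ` {\<lfloor>a / (2 * pi)\<rfloor>..\<lceil>b / (2 * pi)\<rceil>}"
      using n(1) by (auto simp: mult.assoc)
  qed
qed simp

text \<open>
  Near a zero the equation forces \<open>u \<approx> c |\<theta>|\<^sup>\<beta>\<close> with \<open>\<beta> = 2/(2-p)\<close>, so one tries \<open>u = h\<^sup>\<gamma>\<close> with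
  \<open>\<gamma> = \<beta>/2\<close> and \<open>h\<close> vanishing to second order. The choice \<open>h = 1 - cos \<theta>\<close> makes the resulting
  \<open>f\<close> negative at \<open>\<theta> = \<pi>\<close> when \<open>\<gamma> > 2\<close>; dividing by \<open>1 + \<gamma> (1 - cos \<theta>)/4\<close> repairs this.
\<close>

lemma vanishing_solution_exists:
  fixes p :: real
  assumes p: "0 < p" "p < 2"
  shows "\<exists>\<alpha>\<in>{0<..<1}. \<exists>f. holder_circle \<alpha> f \<and> (\<forall>\<theta>. f \<theta> > 0) \<and>
    (\<exists>u. nonneg_generalized_solution p f u \<and> (\<exists>\<theta>. u \<theta> = 0))"
proof -
  define \<gamma> where "\<gamma> = 1 / (2 - p)"
  have \<gamma>: "\<gamma> > 1 / 2" using p by (simp add: \<gamma>_def field_simps)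
  \<comment> \<open>This makes u^(p-1) = h^(\<gamma>-1), the power appearing in
    \<open>F\<close>.\<close>
  have \<gamma>p: "\<gamma> * (p - 1) = \<gamma> - 1" using p by (simp add: \<gamma>_def field_simps)
  define t where "t x = 1 - cos x" for x :: real
  define D where "D x = 1 + \<gamma> / 4 * t x" for x
  define h where "h x = t x / D x" for x
  \<comment> \<open>\<open>h1\<close> and \<open>h2\<close> are the first two derivatives of
    \<open>h\<close>. Since D - (\<gamma>/4) t = 1, the quotient rule collapses to sin /
    D^2.\<close>
  define h1 where "h1 x = sin x / (D x)\<^sup>2" for x
  define h2 where "h2 x = (cos x * D x - \<gamma> / 2 * (sin x)\<^sup>2) / (D x)^3" for x
  \<comment> \<open>Solving the equation for f gives f h = \<gamma> h h'' + \<gamma> (\<gamma> - 1)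
    h'^2 + h^2. With s = 1 - cos x and sin^2 x = s (2 - s), the right-hand side is s N(s) /
    D^4.\<close>
  define N where "N s = \<gamma>\<^sup>2 * ((s - 2)\<^sup>2 * (s + 8) / 16) - \<gamma> * (1 - s\<^sup>2 / 2) + s" for s :: real
  define f where "f x = N (t x) / (D x)^3" for x
  define u where "u x = h x powr \<gamma>" for x
  define u1 where "u1 x = \<gamma> * h x powr (\<gamma> - 1) * h1 x" for x
  define F where "F x = f x * h x powr (\<gamma> - 1)" for x
  have t: "0 \<le> t x" "t x \<le> 2" for x by (simp_all add: t_def)
  have D: "1 \<le> D x" "D x \<le> 1 + \<gamma> / 2" for x
    using t[of x] \<gamma> by (auto simp: D_def)
  have D0: "D x > 0" for x using D(1)[of x] by linarith
  have h: "0 \<le> h x" "h x = 0 \<longleftrightarrow> t x = 0" for x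
    using t[of x] D0[of x] by (auto simp: h_def)
  have N_pos: "N s > 0" if "0 \<le> s" "s \<le> 2" for s
  proof -
    \<comment> \<open>Expanded in powers of e > 0, all coefficients of \<open>N\<close> are
      nonnegative on [0, 2]. The constant one vanishes at s = 0 and the quadratic one at s = 2, but
      the linear one is positive throughout.\<close>
    define e where "e = \<gamma> - 1 / 2"
    have "N s = (s^3 + 20 * s\<^sup>2 + 36 * s) / 64 + e * ((s - 1)\<^sup>2 * (s + 14) + (2 - s)) / 16
        + e\<^sup>2 * ((s - 2)\<^sup>2 * (s + 8) / 16)"
      unfolding N_def e_def by (simp add: field_simps power2_eq_square power3_eq_cube)
    moreover have "0 < (s - 1)\<^sup>2 * (s + 14) + (2 - s)"
      by (cases "s = 2") (use that in \<open>auto intro: add_nonneg_pos\<close>)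
    moreover have "e > 0" using \<gamma> by (simp add: e_def)
    ultimately show ?thesis
      using that by (simp add: add_nonneg_pos add_pos_nonneg)
  qed
  have f_pos: "f x > 0" for x
    using N_pos[OF t] D0[of x] by (simp add: f_def)
  have dt: "(t has_real_derivative sin x) (at x)" for x
    unfolding t_def by (rule derivative_eq_intros refl)+ simp
  have dD: "(D has_real_derivative \<gamma> / 4 * sin x) (at x)" for x
    unfolding D_def by (rule derivative_eq_intros dt refl)+ simp
  have dh: "(h has_real_derivative h1 x) (at x)" for x
    unfolding h_def by (rule derivative_eq_intros dt dD refl | use D0[of x] in force)+
      (use D0[of x] in \<open>simp add: h1_def field_simps power2_eq_square D_def\<close>)
  have dh1: "(h1 has_real_derivative h2 x) (at x)" for x
    unfolding h1_def by (rule derivative_eq_intros dD refl | use D0[of x] in force)+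
      (use D0[of x] in \<open>simp add: h2_def field_simps power2_eq_square power3_eq_cube\<close>)
  have cont: "continuous_on A t" "continuous_on A D" "continuous_on A h" "continuous_on A h1" for A
    using dt dD dh dh1 DERIV_isCont by (blast intro: continuous_at_imp_continuous_on)+
  \<comment> \<open>This is the equation for u = h^\<gamma> multiplied by h^(2-\<gamma>), hence free
    of real powers; after division by D^4 is set aside it is a polynomial identity in
    \<open>t x\<close>.\<close>
  have key: "\<gamma> * h2 x * h x + \<gamma> * (\<gamma> - 1) * (h1 x)\<^sup>2 + (h x)\<^sup>2 = f x * h x" for x
  proof -
    have trig: "(sin x)\<^sup>2 = t x * (2 - t x)" "cos x = 1 - t x"
      by (simp_all add: t_def sin_squared_eq algebra_simps power2_eq_square)
    have eqs: "h2 x * h x = ((1 - t x) * D x - \<gamma> / 2 * (t x * (2 - t x))) * t x / (D x)^4"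
      "(h1 x)\<^sup>2 = t x * (2 - t x) / (D x)^4" "(h x)\<^sup>2 = (t x)\<^sup>2 * (D x)\<^sup>2 / (D x)^4"
      "f x * h x = N (t x) * t x / (D x)^4"
      using D0[of x] unfolding h2_def h_def h1_def f_def trig[symmetric] trig(2)[symmetric]
      by (simp_all add: power_divide power2_eq_square power3_eq_cube power4_eq_xxxx trig(2) mult.assoc)
    have "\<gamma> * h2 x * h x + \<gamma> * (\<gamma> - 1) * (h1 x)\<^sup>2 + (h x)\<^sup>2 =
        (\<gamma> * (((1 - t x) * D x - \<gamma> / 2 * (t x * (2 - t x))) * t x)
          + \<gamma> * (\<gamma> - 1) * (t x * (2 - t x)) + (t x)\<^sup>2 * (D x)\<^sup>2) / (D x)^4"
      unfolding mult.assoc[of \<gamma> "h2 x"] eqs by (simp only: add_divide_distrib times_divide_eq_right)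
    also have "\<gamma> * (((1 - t x) * D x - \<gamma> / 2 * (t x * (2 - t x))) * t x)
        + \<gamma> * (\<gamma> - 1) * (t x * (2 - t x)) + (t x)\<^sup>2 * (D x)\<^sup>2 = N (t x) * t x"
      by (simp add: N_def D_def field_simps power2_eq_square)
    finally show ?thesis by (simp only: eqs)
  qed
  have h_pos: "h x > 0" if "cos x \<noteq> 1" for x
    using h[of x] that by (auto simp: t_def less_le)
  have cont_u: "continuous_on UNIV u"
    unfolding u_def using h \<gamma> by (intro continuous_on_powr' cont continuous_intros) auto
  have cont_u1: "continuous_on UNIV u1"
  proof -
    \<comment> \<open>For \<gamma> < 1 the factor h^(\<gamma>-1) blows up at the zeros, but |h'| is
      at most a multiple of h^(1/2). The remaining exponent \<gamma> - 1/2 is positive, so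
      \<open>u1\<close> tends to 0 there, which is also its value because \<open>powr\<close> has
      value 0 at base 0.\<close>
    have bound: "\<bar>u1 x\<bar> \<le> \<gamma> * sqrt (2 + \<gamma>) * h x powr (\<gamma> - 1 / 2)" for x
    proof (cases "h x = 0")
      case False
      have "(sin x)\<^sup>2 = t x * (2 - t x)"
        by (simp add: t_def sin_squared_eq algebra_simps power2_eq_square)
      also have "\<dots> \<le> t x * 2" using t by (intro mult_left_mono) auto
      also have "t x = h x * D x" using D0[of x] by (simp add: h_def)
      also have "h x * D x * 2 \<le> h x * (1 + \<gamma> / 2) * 2"
        using D h(1) by (intro mult_right_mono mult_left_mono) auto
      finally have "\<bar>sin x\<bar> \<le> sqrt ((2 + \<gamma>) * h x)"
        by (intro real_le_rsqrt) (simp add: algebra_simps)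
      also have "\<dots> = sqrt (2 + \<gamma>) * h x powr (1 / 2)"
        using h(1)[of x] by (simp add: real_sqrt_mult powr_half_sqrt)
      finally have "\<bar>sin x\<bar> \<le> sqrt (2 + \<gamma>) * h x powr (1 / 2)" .
      moreover have "\<bar>h1 x\<bar> \<le> \<bar>sin x\<bar>"
        using D(1)[of x] by (simp add: h1_def abs_mult divide_le_eq mult_le_cancel_left1)
      ultimately have "\<bar>h1 x\<bar> \<le> sqrt (2 + \<gamma>) * h x powr (1 / 2)" by linarith
      then have "\<gamma> * h x powr (\<gamma> - 1) * \<bar>h1 x\<bar> \<le> \<gamma> * h x powr (\<gamma> - 1) * (sqrt (2 + \<gamma>) * h x powr (1 / 2))"
        using \<gamma> by (intro mult_left_mono) auto
      also have "\<dots> = \<gamma> * sqrt (2 + \<gamma>) * (h x powr (\<gamma> - 1) * h x powr (1 / 2))" by simp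
      also have "h x powr (\<gamma> - 1) * h x powr (1 / 2) = h x powr (\<gamma> - 1 / 2)"
        by (simp flip: powr_add)
      finally show ?thesis using \<gamma> by (simp add: u1_def abs_mult)
    qed (simp add: u1_def)
    have "isCont u1 x" for x
    proof (cases "h x = 0")
      case True
      have "continuous_on UNIV (\<lambda>x. \<gamma> * sqrt (2 + \<gamma>) * h x powr (\<gamma> - 1 / 2))"
        using h \<gamma> by (intro continuous_on_mult continuous_on_powr' cont continuous_intros) auto
      then have "((\<lambda>y. \<gamma> * sqrt (2 + \<gamma>) * h y powr (\<gamma> - 1 / 2)) \<longlongrightarrow> 0) (at x)"
        using True by (simp add: continuous_on_def)
          (metis (mono_tags, lifting) UNIV_I mult_zero_right powr_0)
      then have "(u1 \<longlongrightarrow> 0) (at x)"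
        by (rule Lim_null_comparison[rotated]) (use bound in \<open>auto intro!: always_eventually\<close>)
      then show ?thesis using True by (simp add: isCont_def u1_def)
    next
      case False
      then show ?thesis unfolding u1_def
        using DERIV_isCont[OF dh] DERIV_isCont[OF dh1] by (intro continuous_intros) auto
    qed
    then show ?thesis by (simp add: continuous_at_imp_continuous_on)
  qed
  interpret support_ode u u1 F "{x. cos x = 1}"
  proof
    show "0 \<le> F x" for x using f_pos[of x] by (simp add: F_def)
    fix x :: real assume "x \<notin> {x. cos x = 1}"
    then have hx: "h x > 0" using h_pos by simp
    show "(u has_real_derivative u1 x) (at x)"
      unfolding u_def by (rule derivative_eq_intros dh hx refl)+ (simp add: u1_def)
    \<comment> \<open>Extracting the common factor h^(\<gamma>-2) reduces the equation to
      \<open>key\<close>.\<close>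
    have pw: "h x powr (\<gamma> - 1) = h x powr (\<gamma> - 2) * h x" "h x powr \<gamma> = h x powr (\<gamma> - 2) * (h x)\<^sup>2"
      using hx by (simp_all add: powr_mult_base powr_diff power2_eq_square field_simps)
    have "(u1 has_real_derivative
        \<gamma> * ((\<gamma> - 1) * h x powr (\<gamma> - 2) * h1 x) * h1 x + \<gamma> * h x powr (\<gamma> - 1) * h2 x) (at x)"
      unfolding u1_def by (rule derivative_eq_intros dh dh1 hx refl)+ (simp add: algebra_simps)
    moreover have "\<gamma> * ((\<gamma> - 1) * h x powr (\<gamma> - 2) * h1 x) * h1 x + \<gamma> * h x powr (\<gamma> - 1) * h2 x
        = h x powr (\<gamma> - 2) * (\<gamma> * h2 x * h x + \<gamma> * (\<gamma> - 1) * (h1 x)\<^sup>2)"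
      by (simp add: pw algebra_simps power2_eq_square)
    moreover have "\<dots> = h x powr (\<gamma> - 2) * (f x * h x - (h x)\<^sup>2)" using key[of x] by simp
    moreover have "\<dots> = F x - u x" by (simp add: F_def u_def pw algebra_simps)
    ultimately show "(u1 has_real_derivative F x - u x) (at x)" by simp
  qed (fact cont_u cont_u1 finite_cos_eq_1)+
  have per: "circle_fun u" "circle_fun u1"
    by (simp_all add: periodic_fun_simple_def u_def u1_def h_def h1_def D_def t_def)
  define u0 where "u0 = (1 / 2 / (1 + \<gamma> / 2)) powr \<gamma>"
  have u0: "u0 > 0" using \<gamma> by (simp add: u0_def)
  have u_ge: "u0 \<le> u x" if "t x \<ge> 1 / 2" for x
    unfolding u0_def u_def h_def using that \<gamma> D[of x] D0[of x] by (intro powr_mono2 frac_le) auto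
  \<comment> \<open>Where cos x \<le> 1/2, \<open>u\<close> is at least \<open>u0\<close> and the
    left-hand side at most 3 u0 / 4. Elsewhere the left-hand side is at most 0, which is why the
    centre is shifted away from the direction of the zero.\<close>
  have ball: "(- u0 / 2) * cos x + 0 * sin x + u0 / 4 \<le> u x" for x
  proof (cases "t x \<ge> 1 / 2")
    case True
    have "u0 * (- 1) \<le> u0 * cos x" using u0 by (intro mult_left_mono) auto
    then show ?thesis using u_ge[OF True] u0 by simp
  next
    case False
    then have "u0 * (1 / 2) \<le> u0 * cos x" using u0 by (intro mult_left_mono) (auto simp: t_def)
    moreover have "0 \<le> u x" by (simp add: u_def)
    ultimately show ?thesis by simp
  qed
  define N' where "N' s = \<gamma>\<^sup>2 * ((2 * (s - 2) * (s + 8) + (s - 2)\<^sup>2) / 16) + \<gamma> * s + 1" for s :: real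
  have dN: "(N has_real_derivative N' s) (at s)" for s
    unfolding N_def by (auto intro!: derivative_eq_intros simp: N'_def field_simps power2_eq_square)
  define f' where "f' x = (N' (t x) * sin x * (D x)^3
      - N (t x) * (3 * (D x)\<^sup>2 * (\<gamma> / 4 * sin x))) / ((D x)^3 * (D x)^3)" for x
  have df: "(f has_real_derivative f' x) (at x)" for x
    unfolding f_def
    by (rule derivative_eq_intros DERIV_chain2[OF dN dt] dD refl | use D0[of x] in force)+
      (simp add: f'_def)
  have cont_f': "continuous_on UNIV f'"
    unfolding f'_def N_def N'_def
    by (intro continuous_intros cont) (use D0 in \<open>auto simp: less_imp_neq[symmetric]\<close>)
  have "circle_fun f" "circle_fun f'"
    by (simp_all add: periodic_fun_simple_def f_def f'_def D_def t_def)
  then have "holder_circle (1 / 2) f"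
    using C1_imp_holder_circle[of f f' "1 / 2"] df cont_f' by auto
  moreover have "nonneg_generalized_solution p f u"
  proof (rule generalized_solution[OF per, where v = "- u0 / 2" and w = 0 and \<epsilon> = "u0 / 4"])
    show "continuous_on UNIV f"
      using df DERIV_isCont by (blast intro: continuous_at_imp_continuous_on)
    show "F x = f x * u x powr (p - 1)" for x by (simp add: F_def u_def powr_powr \<gamma>p)
    show "u x \<noteq> 0" if "x \<notin> {x. cos x = 1}" for x
      using h_pos[of x] that by (simp add: u_def)
    show "0 < u0 / 4" using u0 by simp
  qed (use f_pos ball in \<open>auto simp: u_def\<close>)
  moreover have "u 0 = 0" by (simp add: u_def h_def t_def)
  ultimately show ?thesis
    using f_pos by (intro bexI[of _ "1 / 2"] exI[of _ f] conjI exI[of _ u] exI[of _ 0]) auto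
qed

theorem theorem1p2:
  fixes p :: real
  assumes "0 < p" and "p < 2"
  shows
    "(\<forall>f. (\<forall>\<theta>. f \<theta> > 0) \<longrightarrow>
        (\<exists>C\<ge>1. \<forall>\<alpha>\<in>{0<..<1}. holder_circle \<alpha> f \<longrightarrow>
           (\<forall>u. positive_classical_solution p \<alpha> f u \<longrightarrow>
              inverse C \<le> min_width u \<and> min_width u \<le> max_width u \<and> max_width u \<le> C))) \<and>
     (\<exists>\<alpha>\<in>{0<..<1}. \<exists>f. holder_circle \<alpha> f \<and> (\<forall>\<theta>. f \<theta> > 0) \<and>
        (\<exists>u. nonneg_generalized_solution p f u \<and> (\<exists>\<theta>. u \<theta> = 0)))"
proof (intro conjI allI impI)
  fix f :: "real \<Rightarrow> real" assume fpos: "\<forall>\<theta>. f \<theta> > 0"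
  show "\<exists>C\<ge>1. \<forall>\<alpha>\<in>{0<..<1}. holder_circle \<alpha> f \<longrightarrow>
      (\<forall>u. positive_classical_solution p \<alpha> f u \<longrightarrow>
        inverse C \<le> min_width u \<and> min_width u \<le> max_width u \<and> max_width u \<le> C)"
  \<comment> \<open>\<open>C\<close> has to be chosen before \<alpha>. If \<open>f\<close> is
    Hoelder continuous for no exponent, the claim is vacuous; otherwise any one exponent gives the
    periodicity and continuity from which \<open>C\<close> is built.\<close>
  proof (cases "\<exists>\<alpha>\<in>{0<..<1}. holder_circle \<alpha> f")
    case True
    then have "circle_fun f" "continuous_on UNIV f"
      unfolding holder_circle_def[of _ f] using holder_circle_continuous[of _ f] True by auto
    then obtain C where "C \<ge> 1" "\<And>\<alpha> u. positive_classical_solution p \<alpha> f u \<Longrightarrow>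
        inverse C \<le> min_width u \<and> min_width u \<le> max_width u \<and> max_width u \<le> C"
      using width_bounds[OF assms, of f] fpos by blast
    then show ?thesis by blast
  next
    case False
    then show ?thesis by (intro exI[of _ 1]) auto
  qed
qed (rule vanishing_solution_exists[OF assms])

end
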